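(* Let $p\ge 1$, let $Q\subseteq\{0,1\}^p$ be such that for every $i\in[p]$ there exists $z\in Q$ with $z_i=1$, and let $f:\mathbb{R}\to\mathbb{R}$ be convex with $f(0)=0$. Let $$Z_Q=\left\{(z,\beta,t)\in Q\times\mathbb{R}^p\times\mathbb{R}\;:\; f(\mathbf 1^\top\beta)\le t,\ \beta_i(1-z_i)=0\ \ \forall i\in[p]\right\}.$$ Let $\mathcal F\subseteq\mathbb{R}^p$ be any finite set such that $$\operatorname{conv}(Q\setminus\{\mathbf 0\})=\operatorname{conv}(Q)\cap\{z\in\mathbb{R}^p:\ \pi^\top z\ge 1\ \ \forall \pi\in\mathcal F\}.$$ If the graph $G_Q$ is connected, then $$\operatorname{cl\,conv}(Z_Q)=\Big\{(z,\beta,t)\in[0,1]^p\times\mathbb{R}^p\times\mathbb{R}\;:\; z\in\operatorname{conv}(Q),\ t\ge f(\mathbf 1^\top\beta),\ t\ge(\pi^\top z)\,f\Big(\frac{\mathbf 1^\top\beta}{\pi^\top z}\Big)\ \ \forall\pi\in\mathcal F\Big\}.$$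
   Context: Notation: $[p]=\{1,\dots,p\}$; $\mathbf 0,\mathbf 1$ are the all-zeros and all-ones vectors; $\operatorname{conv}$ denotes convex hull and $\operatorname{cl\,conv}$ the closure of the convex hull. Graph $G_Q$: it has vertex set $[p]$, and for $i\ne j$, $\{i,j\}$ is an edge if and only if there exists $z\in Q$ with $z_i=z_j=1$. Convention for perspectives: for $w>0$ the expression $w f(x/w)$ is the usual one, and for $w=0$ it is understood as $0f(x/0):=\lim_{w\to0^+}w f(x/w)\in(-\infty,+\infty]$ (an inequality $t\ge +\infty$ is never satisfied by real $t$). *)

theory Defs
  imports "Graph_Theory.Graph_Theory" "HOL-Analysis.Analysis"
begin

(* The perspective value w f(x / w) for w >= 0, with the limit convention at w = 0;
   the lemma perspective_tendsto below shows that this limit exists for convex f with f 0 = 0.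
   The value for w < 0 has no meaning and is not used. *)
definition perspective :: "(real \<Rightarrow> real) \<Rightarrow> real \<Rightarrow> real \<Rightarrow> ereal" where
  "perspective f w x =
     (if w = 0 then Lim (at_right 0) (\<lambda>u. ereal (u * f (x / u))) else ereal (w * f (x / w)))"

definition Z_set :: "(real ^ 'p) set \<Rightarrow> (real \<Rightarrow> real) \<Rightarrow> ((real ^ 'p) \<times> (real ^ 'p) \<times> real) set" where
  "Z_set Q f =
     {(z, \<beta>, t). z \<in> Q \<and> f (1 \<bullet> \<beta>) \<le> t \<and> (\<forall>i. \<beta> $ i * (1 - z $ i) = 0)}"

(* The undirected graph as a symmetric loop-free digraph. *)
definition support_graph :: "(real ^ 'p) set \<Rightarrow> 'p pair_pre_digraph" where
  "support_graph Q =
     \<lparr> pverts = UNIV, parcs = {(i, j). i \<noteq> j \<and> (\<exists>z\<in>Q. z $ i = 1 \<and> z $ j = 1)} \<rparr>"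

lemma pair_graph_support_graph: "pair_graph (support_graph (Q :: (real ^ 'p) set))"
  by unfold_locales
    (auto simp: support_graph_def symmetric_def arcs_ends_def arc_to_ends_def with_proj_def sym_def)

lemma perspective_antimono:
  fixes f :: "real \<Rightarrow> real"
  assumes "convex_on UNIV f" "f 0 = 0" "0 < u" "u \<le> v"
  shows "v * f (x / v) \<le> u * f (x / u)"
proof -
  have "f ((1 - u / v) *\<^sub>R 0 + (u / v) *\<^sub>R (x / u)) \<le> (1 - u / v) * f 0 + (u / v) * f (x / u)"
    by (rule convex_onD[OF assms(1)]) (use assms in auto)
  moreover have "(1 - u / v) *\<^sub>R 0 + (u / v) *\<^sub>R (x / u) = x / v"
    using assms by simp
  ultimately have "f (x / v) \<le> u / v * f (x / u)"
    using assms by simp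
  then have "v * f (x / v) \<le> v * (u / v * f (x / u))"
    using assms by (intro mult_left_mono) auto
  then show ?thesis using assms by simp
qed

lemma perspective_tendsto:
  fixes f :: "real \<Rightarrow> real"
  assumes "convex_on UNIV f" "f 0 = 0"
  shows "((\<lambda>u. ereal (u * f (x / u))) \<longlongrightarrow> perspective f 0 x) (at_right 0)"
proof -
  let ?g = "\<lambda>u. ereal (u * f (x / u))"
  let ?l = "SUP u\<in>{0<..}. ?g u"
  have lim: "(?g \<longlongrightarrow> ?l) (at_right 0)"
  proof (rule order_tendstoI)
    fix a assume "a < ?l"
    then obtain v where v: "0 < v" "a < ?g v"
      by (auto simp: less_SUP_iff)
    show "\<forall>\<^sub>F u in at_right 0. a < ?g u"
      using eventually_at_right_less[of 0] eventually_at_right_real[OF v(1)]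
    proof eventually_elim
      case (elim u)
      then have "?g v \<le> ?g u"
        using perspective_antimono[OF assms, of u v x] by simp
      then show ?case using v by order
    qed
  next
    fix a assume a: "?l < a"
    show "\<forall>\<^sub>F u in at_right 0. ?g u < a"
      using eventually_at_right_less[of 0]
    proof eventually_elim
      case (elim u)
      then have "?g u \<le> ?l" by (intro SUP_upper) auto
      then show ?case using a by order
    qed
  qed
  then have "Lim (at_right 0) ?g = ?l"
    by (intro tendsto_Lim) auto
  with lim show ?thesis by (simp add: perspective_def)
qed

end

theory Submission
  imports Defs
begin

text \<open>
  Write \<open>s = 1 \<bullet> \<beta>\<close>. The proof rests on two observations.

  \<^item> For \<open>w \<ge> 0\<close>, the inequality \<open>perspective f w s \<le> t\<close> says that
    \<open>a * s + b * w \<le> t\<close> for every affine minorant \<open>y \<mapsto> a * y + b\<close> of \<open>f\<close>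
    (\<open>perspective_le_iff\<close>); this form also covers the limit at \<open>w = 0\<close>. Hence the right-hand
    side is the product of the polytope \<open>convex hull Q\<close> with a whole space, cut by closed
    half-spaces, so it is closed and convex (\<open>convex_closed_perspective_region\<close>). It contains
    \<open>Z_set Q f\<close>: over \<open>z \<noteq> 0\<close> in \<open>Q\<close> one has \<open>\<pi> \<bullet> z \<ge> 1\<close>, and \<open>w * f (s / w)\<close>
    is nonincreasing in \<open>w\<close>, so the constraints of \<open>F\<close> follow from \<open>f s \<le> t\<close>; over \<open>z = 0\<close> the
    vector \<open>\<beta>\<close> vanishes.

  \<^item> The closed convex hull of \<open>Z_set Q f\<close> depends on \<open>\<beta>\<close> only through \<open>s\<close>
    (\<open>sum_zero_direction\<close>). An edge \<open>{i, j}\<close> yields a line in the direction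
    \<open>axis i 1 - axis j 1\<close> inside \<open>Z_set Q f\<close>, because \<open>s = 0\<close> along it. A closed convex set
    is invariant under the direction of any line that it contains, and when the graph is connected
    the edge directions span the hyperplane of vectors with coordinate sum zero.

  For the inclusion from right to left, let \<open>(z, \<beta>, t)\<close> satisfy the constraints and let \<open>w\<close> be
  the minimum of \<open>1\<close> and all \<open>\<pi> \<bullet> z\<close>. If \<open>z \<noteq> 0\<close>, then \<open>w > 0\<close> and \<open>z / w\<close> lies in
  \<open>convex hull (Q - {0})\<close>, by the description of that hull through \<open>F\<close>. Convex combinations of
  points of \<open>Z_set Q f\<close> over \<open>Q - {0}\<close> give points over \<open>z / w\<close> at height \<open>t / w \<ge> f (s / w)\<close>;
  mixing with the origin in proportion \<open>w\<close> to \<open>1 - w\<close> (where \<open>w = 1\<close> unless \<open>0 \<in> Q\<close>) gives \<open>(z, \<beta>, t)\<close> up to a change of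
  \<open>\<beta>\<close> with fixed sum (\<open>closure_convex_hull_Z_set_scaled\<close>). If \<open>z = 0\<close>, the same mixtures
  over \<open>v *\<^sub>R z'\<close>, with \<open>z'\<close> in \<open>convex hull (Q - {0})\<close>, converge to \<open>(0, \<beta>, t)\<close> as
  \<open>v\<close> tends to \<open>0\<close>.
\<close>

section \<open>The perspective through affine minorants\<close>

definition affine_minorants :: "(real \<Rightarrow> real) \<Rightarrow> (real \<times> real) set" where
  "affine_minorants f = {(a, b). \<forall>y. a * y + b \<le> f y}"

lemma affine_minorant_touching:
  fixes f :: "real \<Rightarrow> real"
  assumes "convex_on UNIV f"
  obtains a b where "(a, b) \<in> affine_minorants f" "f x = a * x + b"
proof -
  define a where "a = Inf ((\<lambda>t. (f x - f t) / (x - t)) ` ({x<..} \<inter> UNIV))"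
  have "f x + a * (y - x) \<le> f y" for y
    unfolding a_def by (rule convex_le_Inf_differential[OF assms]) auto
  then have "(a, f x - a * x) \<in> affine_minorants f"
    unfolding affine_minorants_def by (auto simp: algebra_simps)
  then show ?thesis using that by simp
qed

lemma le_scaled_affine_minorant:
  assumes "(a, b) \<in> affine_minorants f" "0 < u"
  shows "a * x + b * u \<le> u * f (x / u)"
proof -
  have "a * (x / u) + b \<le> f (x / u)"
    using assms(1) unfolding affine_minorants_def by blast
  then have "u * (a * (x / u) + b) \<le> u * f (x / u)"
    using assms(2) by (intro mult_left_mono) auto
  then show ?thesis using assms(2) by (simp add: algebra_simps)
qed

text \<open>
  The minorant that touches \<open>f\<close> at \<open>x / u\<close> gives \<open>u * f (x / u) = a * x + b * u\<close>. Its intercept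
  satisfies \<open>b \<le> f 0 = 0\<close>, so replacing \<open>u\<close> by a smaller \<open>w\<close> cannot decrease this value. Allowing
  \<open>w < u\<close> makes the lemma usable for \<open>w = 0\<close>.
\<close>
lemma scaled_value_le_if_affine_minorants_le:
  assumes "convex_on UNIV f" "f 0 = 0" "0 < u" "w \<le> u"
    and le: "\<And>a b. (a, b) \<in> affine_minorants f \<Longrightarrow> a * x + b * w \<le> t"
  shows "u * f (x / u) \<le> t"
proof -
  obtain a b where ab: "(a, b) \<in> affine_minorants f" "f (x / u) = a * (x / u) + b"
    using affine_minorant_touching[OF assms(1)] .
  have "b \<le> 0"
    using ab(1) assms(2) unfolding affine_minorants_def by (auto dest: spec[of _ 0])
  have "u * f (x / u) = a * x + b * u"
    using ab(2) assms(3) by (simp add: algebra_simps)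
  also have "\<dots> \<le> a * x + b * w"
    using \<open>b \<le> 0\<close> assms(4) by (simp add: mult_left_mono_neg)
  also have "\<dots> \<le> t" using le[OF ab(1)] .
  finally show ?thesis .
qed

text \<open>
  The epigraph of the perspective as an intersection of half-spaces. For \<open>w > 0\<close> this divides the
  inequalities by \<open>w\<close>; for \<open>w = 0\<close>, letting \<open>u\<close> tend to \<open>0\<close> in
  \<open>a * x + b * u \<le> u * f (x / u)\<close> gives one direction, and the preceding lemma bounds
  \<open>u * f (x / u)\<close> along the whole limit for the other.
\<close>
lemma perspective_le_iff:
  assumes "convex_on UNIV f" "f 0 = 0" "0 \<le> w"
  shows "perspective f w x \<le> ereal t \<longleftrightarrow> (\<forall>(a, b)\<in>affine_minorants f. a * x + b * w \<le> t)"
proof (cases "w = 0")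
  case True
  have lim: "((\<lambda>u. ereal (u * f (x / u))) \<longlongrightarrow> perspective f w x) (at_right 0)"
    using perspective_tendsto[OF assms(1,2)] True by simp
  show ?thesis
  proof safe
    fix a b assume le: "perspective f w x \<le> ereal t" and ab: "(a, b) \<in> affine_minorants f"
    have "((\<lambda>u. ereal (a * x + b * u)) \<longlongrightarrow> ereal (a * x + b * 0)) (at_right 0)"
      by (intro tendsto_intros)
    moreover have "\<forall>\<^sub>F u in at_right 0. ereal (a * x + b * u) \<le> ereal (u * f (x / u))"
      using eventually_at_right_less[of "0::real"]
      by eventually_elim (use le_scaled_affine_minorant[OF ab] in auto)
    ultimately have "ereal (a * x + b * 0) \<le> perspective f w x"
      using lim by (intro tendsto_le[OF trivial_limit_at_right_real])
    from order_trans[OF this le] show "a * x + b * w \<le> t" using True by simp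
  next
    assume le: "\<forall>(a, b)\<in>affine_minorants f. a * x + b * w \<le> t"
    have "\<forall>\<^sub>F u in at_right 0. ereal (u * f (x / u)) \<le> ereal t"
      using eventually_at_right_less[of "0::real"]
    proof eventually_elim
      case (elim u)
      have "u * f (x / u) \<le> t"
        by (rule scaled_value_le_if_affine_minorants_le[OF assms(1,2), where w = w])
          (use elim le True in auto)
      then show ?case by simp
    qed
    then show "perspective f w x \<le> ereal t"
      by (rule tendsto_upperbound[OF lim]) simp
  qed
next
  case False
  then have w: "0 < w" using assms(3) by simp
  then have eq: "perspective f w x \<le> ereal t \<longleftrightarrow> w * f (x / w) \<le> t"
    by (simp add: perspective_def)
  show ?thesis unfolding eq
  proof safe
    fix a b assume le: "w * f (x / w) \<le> t" and ab: "(a, b) \<in> affine_minorants f"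
    show "a * x + b * w \<le> t"
      using le_scaled_affine_minorant[OF ab w, of x] le by simp
  next
    assume le: "\<forall>(a, b)\<in>affine_minorants f. a * x + b * w \<le> t"
    show "w * f (x / w) \<le> t"
      by (rule scaled_value_le_if_affine_minorants_le[OF assms(1,2) w order_refl]) (use le in auto)
  qed
qed

lemma scaled_value_le_if_perspective_le:
  assumes "convex_on UNIV f" "f 0 = 0" "0 \<le> w" "w \<le> u" "0 < u" "perspective f w x \<le> ereal t"
  shows "u * f (x / u) \<le> t"
  by (rule scaled_value_le_if_affine_minorants_le[OF assms(1,2,5,4)])
    (use assms(6) in \<open>auto simp: perspective_le_iff[OF assms(1-3)]\<close>)

section \<open>Convexity and closedness of the right-hand side\<close>

text \<open>
  The half-spaces \<open>A\<close> express \<open>f (1 \<bullet> \<beta>) \<le> t\<close>, the case \<open>w = 1\<close> of the characterisation by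
  minorants, and \<open>B \<pi>\<close> expresses the constraint of \<open>\<pi>\<close>. Both are linear in \<open>(z, \<beta>, t)\<close>
  because \<open>a * (1 \<bullet> \<beta>) + b * (\<pi> \<bullet> z)\<close> is.
\<close>
lemma convex_closed_perspective_region:
  fixes Q F :: "(real ^ 'p) set"
  assumes f: "convex_on UNIV f" "f 0 = 0"
    and P: "convex P" "closed P"
    and nonneg: "\<And>\<pi> z. \<pi> \<in> F \<Longrightarrow> z \<in> P \<Longrightarrow> 0 \<le> \<pi> \<bullet> z"
  defines "R \<equiv> {(z, \<beta> :: real ^ 'p, t). z \<in> P \<and> f (1 \<bullet> \<beta>) \<le> t \<and>
                   (\<forall>\<pi>\<in>F. perspective f (\<pi> \<bullet> z) (1 \<bullet> \<beta>) \<le> ereal t)}"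
  shows "convex R" "closed R"
proof -
  define A :: "((real ^ 'p) \<times> (real ^ 'p) \<times> real) set" where
    "A = (\<Inter>(a, b)\<in>affine_minorants f. {x. (0, a *\<^sub>R 1, -1) \<bullet> x \<le> - b})"
  define B :: "(real ^ 'p) \<Rightarrow> ((real ^ 'p) \<times> (real ^ 'p) \<times> real) set" where
    "B \<pi> = (\<Inter>(a, b)\<in>affine_minorants f. {x. (b *\<^sub>R \<pi>, a *\<^sub>R 1, -1) \<bullet> x \<le> 0})" for \<pi>
  have f_le_iff: "f x \<le> t \<longleftrightarrow> (\<forall>(a, b)\<in>affine_minorants f. a * x + b \<le> t)" for x t
    using perspective_le_iff[OF f, of 1 x t] by (simp add: perspective_def)
  have "(z, \<beta>, t) \<in> R \<longleftrightarrow> (z, \<beta>, t) \<in> (P \<times> UNIV) \<inter> A \<inter> (\<Inter>\<pi>\<in>F. B \<pi>)" for z \<beta> t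
  proof -
    have "f (1 \<bullet> \<beta>) \<le> t \<longleftrightarrow> (z, \<beta>, t) \<in> A"
      unfolding A_def f_le_iff by (auto simp: algebra_simps)
    moreover have "perspective f (\<pi> \<bullet> z) (1 \<bullet> \<beta>) \<le> ereal t \<longleftrightarrow> (z, \<beta>, t) \<in> B \<pi>"
      if "\<pi> \<in> F" "z \<in> P" for \<pi>
      unfolding B_def perspective_le_iff[OF f nonneg[OF that]] by (auto simp: algebra_simps)
    ultimately show ?thesis unfolding R_def by auto
  qed
  then have R: "R = (P \<times> UNIV) \<inter> A \<inter> (\<Inter>\<pi>\<in>F. B \<pi>)" by auto
  show "convex R"
    unfolding R A_def B_def
    by (intro convex_Int convex_Times convex_INT P convex_UNIV)
      (auto intro: convex_halfspace_le simp del: inner_Pair)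
  show "closed R"
    unfolding R A_def B_def
    by (intro closed_Int closed_Times closed_INT P closed_UNIV)
      (auto intro!: closed_halfspace_le simp del: inner_Pair)
qed

section \<open>Lines in the closed convex hull\<close>

text \<open>
  The segments from \<open>x\<close> to points of the line that run off to infinity approach the ray from \<open>x\<close>
  in the direction \<open>v\<close>.
\<close>
lemma closed_convex_add_line_direction:
  fixes C :: "'a::real_normed_vector set"
  assumes C: "convex C" "closed C" and x: "x \<in> C" and y: "\<And>c. y + c *\<^sub>R v \<in> C"
  shows "x + v \<in> C"
proof (rule closed_sequentially[OF C(2)])
  let ?e = "\<lambda>n. 1 / real (Suc n)"
  have "(\<lambda>n. x + v + ?e n *\<^sub>R (y - x)) \<longlonglongrightarrow> x + v + 0 *\<^sub>R (y - x)"
    by (intro tendsto_intros LIMSEQ_Suc[OF lim_1_over_n])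
  then show "(\<lambda>n. x + v + ?e n *\<^sub>R (y - x)) \<longlonglongrightarrow> x + v" by simp
  fix n
  have "(1 - ?e n) *\<^sub>R x + ?e n *\<^sub>R (y + real (Suc n) *\<^sub>R v) \<in> C"
    by (rule convexD_alt[OF C(1) x y]) auto
  moreover have "(1 - ?e n) *\<^sub>R x + ?e n *\<^sub>R (y + real (Suc n) *\<^sub>R v) = x + v + ?e n *\<^sub>R (y - x)"
    by (simp add: algebra_simps del: of_nat_Suc)
  ultimately show "x + v + ?e n *\<^sub>R (y - x) \<in> C" by simp
qed

lemma inner_one_axis [simp]: "(1 :: real ^ 'p) \<bullet> axis i c = c"
  by (simp add: inner_axis)

lemma axis_component: "axis i c $ j = (if j = i then c else 0)"
  by (simp add: axis_def)

text \<open>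
  A common support point \<open>z\<close> allows \<open>\<beta>\<close> to be any multiple of \<open>axis i 1 - axis j 1\<close>; along this
  line \<open>f (1 \<bullet> \<beta>) = f 0 = 0\<close>, so the height can stay \<open>0\<close>.
\<close>
lemma axis_diff_direction_if_adjacent:
  fixes Q :: "(real ^ 'p) set"
  assumes "f 0 = 0" "z \<in> Q" "z $ i = 1" "z $ j = 1"
    and x: "x \<in> closure (convex hull Z_set Q f)"
  shows "x + (0, axis i c - axis j c, 0) \<in> closure (convex hull Z_set Q f)"
proof (rule closed_convex_add_line_direction[OF _ _ x, where y = "(z, 0, 0)"])
  fix d :: real
  have "(z, d *\<^sub>R (axis i c - axis j c), 0) \<in> Z_set Q f"
    using assms by (auto simp: Z_set_def inner_diff_right axis_component)
  then show "(z, 0, 0) + d *\<^sub>R (0, axis i c - axis j c, 0) \<in> closure (convex hull Z_set Q f)"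
    by (auto intro: subsetD[OF closure_subset] hull_inc)
qed (auto intro: convex_closure)

text \<open>Along a path in the graph, the directions of the edges telescope.\<close>
lemma axis_diff_direction:
  fixes Q :: "(real ^ 'p) set"
  assumes f: "f 0 = 0"
    and conn: "Digraph_Component.connected (with_proj (support_graph Q))"
  shows "\<forall>x \<in> closure (convex hull Z_set Q f).
           x + (0, axis i c - axis j c, 0) \<in> closure (convex hull Z_set Q f)"
    (is "?P i j")
proof -
  interpret pair_graph "support_graph Q" by (rule pair_graph_support_graph)
  have "i \<rightarrow>\<^sup>*\<^bsub>with_proj (mk_symmetric (with_proj (support_graph Q)))\<^esub> j"
    using conn unfolding Digraph_Component.connected_def strongly_connected_def
    by (simp add: support_graph_def)
  then have "i \<rightarrow>\<^sup>*\<^bsub>with_proj (support_graph Q)\<^esub> j"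
    using reachable_mk_symmetric_eq sym_arcs by blast
  then have "(i, j) \<in> (arcs_ends (with_proj (support_graph Q)))\<^sup>*"
    by (rule reachable_rtranclI)
  then show ?thesis
  proof (induction rule: rtrancl_induct)
    case base
    then show ?case by (simp add: zero_prod_def[symmetric])
  next
    case (step k l)
    from step.hyps(2) obtain z where z: "z \<in> Q" "z $ k = 1" "z $ l = 1"
      by (auto simp: support_graph_def arcs_ends_def arc_to_ends_def with_proj_def)
    show ?case
    proof
      fix x assume "x \<in> closure (convex hull Z_set Q f)"
      then have "(x + (0, axis i c - axis k c, 0)) + (0, axis k c - axis l c, 0)
          \<in> closure (convex hull Z_set Q f)"
        using step.IH axis_diff_direction_if_adjacent[where f = f, OF f z] by blast
      then show "x + (0, axis i c - axis l c, 0) \<in> closure (convex hull Z_set Q f)"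
        by (simp add: add.assoc)
    qed
  qed
qed

text \<open>
  For any fixed \<open>j\<close>, a vector \<open>d\<close> with coordinate sum zero is
  \<open>\<Sum>i\<in>UNIV. axis i (d $ i) - axis j (d $ i)\<close>; the summands are added one at a time.
\<close>
lemma sum_zero_direction:
  fixes Q :: "(real ^ 'p) set"
  assumes f: "f 0 = 0"
    and conn: "Digraph_Component.connected (with_proj (support_graph Q))"
    and mem: "(z, \<beta>, t) \<in> closure (convex hull Z_set Q f)"
    and eq: "1 \<bullet> \<beta>' = 1 \<bullet> \<beta>"
  shows "(z, \<beta>', t) \<in> closure (convex hull Z_set Q f)"
proof -
  fix j :: 'p
  define d where "d = \<beta>' - \<beta>"
  have sum_d: "(\<Sum>i\<in>UNIV. d $ i) = 0"
    using eq by (simp add: d_def inner_vec_def sum_subtractf)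
  have "(z, \<beta> + (\<Sum>i\<in>I. axis i (d $ i) - axis j (d $ i)), t) \<in> closure (convex hull Z_set Q f)"
    for I :: "'p set"
  proof (induction I rule: infinite_finite_induct)
    case (insert i I)
    then have "(z, \<beta> + (\<Sum>i\<in>I. axis i (d $ i) - axis j (d $ i)), t)
        + (0, axis i (d $ i) - axis j (d $ i), 0) \<in> closure (convex hull Z_set Q f)"
      using axis_diff_direction[where f = f, OF f conn, of i "d $ i" j] by blast
    with insert.hyps show ?case
      by (simp add: add.assoc add.commute[of "axis i (d $ i) - axis j (d $ i)"])
  qed (use mem in auto)
  from this[of UNIV] have "(z, \<beta> + (\<Sum>i\<in>UNIV. axis i (d $ i) - axis j (d $ i)), t)
      \<in> closure (convex hull Z_set Q f)" .
  moreover have "(\<Sum>i\<in>UNIV. axis i (d $ i) - axis j (d $ i)) = d"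
  proof (rule vec_eq_iff[THEN iffD2], rule allI)
    fix k
    have "(\<Sum>i\<in>UNIV. axis i (d $ i) $ k) = d $ k"
      by (simp add: axis_component)
    moreover have "(\<Sum>i\<in>UNIV. axis j (d $ i) $ k) = 0"
      using sum_d by (cases "k = j") (simp_all add: axis_component)
    ultimately show "(\<Sum>i\<in>UNIV. axis i (d $ i) - axis j (d $ i)) $ k = d $ k"
      by (simp add: sum_subtractf)
  qed
  ultimately show ?thesis by (simp add: d_def)
qed

section \<open>Points of the closed convex hull\<close>

text \<open>
  Over each nonzero \<open>z\<close> in \<open>Q\<close>, placing the whole sum \<open>s\<close> on one coordinate of the support of
  \<open>z\<close> gives a point of \<open>Z_set Q f\<close>. As \<open>s\<close> and \<open>t\<close> are the same for all these points, they are
  preserved by convex combinations.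
\<close>
lemma convex_hull_Z_set_over_nonzero:
  fixes Q :: "(real ^ 'p) set"
  assumes Q: "Q \<subseteq> {z. \<forall>i. z $ i \<in> {0, 1}}" and z: "z \<in> convex hull (Q - {0})" and "f s \<le> t"
  obtains \<beta> where "1 \<bullet> \<beta> = s" "(z, \<beta>, t) \<in> convex hull Z_set Q f"
proof -
  define S where "S = {z. \<exists>\<beta>. 1 \<bullet> \<beta> = s \<and> (z, \<beta>, t) \<in> convex hull Z_set Q f}"
  have "convex hull (Q - {0}) \<subseteq> S"
  proof (rule hull_minimal)
    show "Q - {0} \<subseteq> S"
    proof
      fix z assume "z \<in> Q - {0}"
      then obtain i where i: "z \<in> Q" "z $ i = 1"
        using Q by (force simp: vec_eq_iff)
      then have "(z, axis i s, t) \<in> Z_set Q f"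
        using assms(3) by (auto simp: Z_set_def axis_component)
      then show "z \<in> S"
        unfolding S_def by (intro CollectI exI[of _ "axis i s"] conjI inner_one_axis hull_inc)
    qed
    show "convex S"
    proof (rule convexI)
      fix x y and u v :: real
      assume "x \<in> S" "y \<in> S" and uv: "0 \<le> u" "0 \<le> v" "u + v = 1"
      then obtain \<beta> \<gamma> where *: "1 \<bullet> \<beta> = s" "(x, \<beta>, t) \<in> convex hull Z_set Q f"
          "1 \<bullet> \<gamma> = s" "(y, \<gamma>, t) \<in> convex hull Z_set Q f"
        unfolding S_def by auto
      have "u *\<^sub>R (x, \<beta>, t) + v *\<^sub>R (y, \<gamma>, t) \<in> convex hull Z_set Q f"
        using * uv by (intro convexD convex_convex_hull)
      moreover have "u * t + v * t = t" "u * s + v * s = s"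
        using uv by (simp_all add: distrib_right[symmetric])
      ultimately show "u *\<^sub>R x + v *\<^sub>R y \<in> S"
        unfolding S_def using * by (auto simp: inner_add_right intro!: exI[of _ "u *\<^sub>R \<beta> + v *\<^sub>R \<gamma>"])
    qed
  qed
  then show ?thesis using z that unfolding S_def by auto
qed

text \<open>
  The point over \<open>z\<close> with sum \<open>(1 \<bullet> \<beta>) / u\<close> and height \<open>t / u\<close>, taken with weight \<open>u\<close>; the
  remaining weight goes to the origin, which lies in \<open>Z_set Q f\<close> when \<open>0 \<in> Q\<close>.
\<close>
lemma closure_convex_hull_Z_set_scaled:
  fixes Q :: "(real ^ 'p) set"
  assumes Q: "Q \<subseteq> {z. \<forall>i. z $ i \<in> {0, 1}}" and f: "f 0 = 0"
    and conn: "Digraph_Component.connected (with_proj (support_graph Q))"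
    and z: "z \<in> convex hull (Q - {0})"
    and u: "0 < u" "u \<le> 1" "u = 1 \<or> 0 \<in> Q"
    and t: "u * f ((1 \<bullet> \<beta>) / u) \<le> t"
  shows "(u *\<^sub>R z, \<beta>, t) \<in> closure (convex hull Z_set Q f)"
proof -
  have "f ((1 \<bullet> \<beta>) / u) \<le> t / u"
    using t u(1) by (simp add: pos_le_divide_eq mult.commute)
  then obtain \<gamma> where \<gamma>: "1 \<bullet> \<gamma> = (1 \<bullet> \<beta>) / u" "(z, \<gamma>, t / u) \<in> convex hull Z_set Q f"
    using convex_hull_Z_set_over_nonzero[OF Q z] by metis
  have "u *\<^sub>R (z, \<gamma>, t / u) \<in> convex hull Z_set Q f"
  proof (cases "u = 1")
    case False
    then have "0 \<in> Z_set Q f"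
      using u(3) f by (simp add: Z_set_def zero_prod_def)
    then have "(1 - u) *\<^sub>R 0 + u *\<^sub>R (z, \<gamma>, t / u) \<in> convex hull Z_set Q f"
      using u \<gamma>(2) by (intro convexD_alt[OF convex_convex_hull] hull_inc[of 0]) auto
    then show ?thesis by simp
  qed (use \<gamma>(2) in simp)
  then have "(u *\<^sub>R z, u *\<^sub>R \<gamma>, t) \<in> closure (convex hull Z_set Q f)"
    using u(1) closure_subset by fastforce
  then show ?thesis
    by (rule sum_zero_direction[where f = f, OF f conn]) (use \<gamma>(1) u(1) in simp)
qed

section \<open>The closed convex hull\<close>

theorem theorem1:
  fixes Q F :: "(real ^ 'p) set" and f :: "real \<Rightarrow> real"
  assumes "Q \<subseteq> {z. \<forall>i. z $ i \<in> {0, 1}}"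
    and "\<forall>i. \<exists>z\<in>Q. z $ i = 1"
    and "convex_on UNIV f" and "f 0 = 0"
    and "finite F"
    and "convex hull (Q - {0}) = convex hull Q \<inter> {z. \<forall>\<pi>\<in>F. \<pi> \<bullet> z \<ge> 1}"
    and "Digraph_Component.connected (with_proj (support_graph Q))"
  shows "closure (convex hull (Z_set Q f)) =
    {(z, \<beta>, t). (\<forall>i. z $ i \<in> {0..1}) \<and> z \<in> convex hull Q \<and> t \<ge> f (1 \<bullet> \<beta>)
       \<and> (\<forall>\<pi>\<in>F. ereal t \<ge> perspective f (\<pi> \<bullet> z) (1 \<bullet> \<beta>))}"
proof -
  note Q = assms(1) and f = assms(3,4) and F = assms(6) and conn = assms(7)
  let ?C = "closure (convex hull Z_set Q f)"
  define R where "R = {(z, \<beta> :: real ^ 'p, t). z \<in> convex hull Q \<and> f (1 \<bullet> \<beta>) \<le> t \<and>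
                   (\<forall>\<pi>\<in>F. perspective f (\<pi> \<bullet> z) (1 \<bullet> \<beta>) \<le> ereal t)}"
  have nonzero: "Q - {0} \<noteq> {}"
  proof -
    obtain z and i :: 'p where "z \<in> Q" "z $ i = 1" using assms(2) by blast
    then show ?thesis by auto
  qed
  have zero_notin: "0 \<notin> convex hull (Q - {0})"
  proof -
    \<comment> \<open>A nonzero 0/1 vector has coordinate sum at least 1, and so do convex combinations of such.\<close>
    have "convex hull (Q - {0}) \<subseteq> {z. 1 \<le> 1 \<bullet> z}"
    proof (rule hull_minimal)
      show "Q - {0} \<subseteq> {z. 1 \<le> 1 \<bullet> z}"
      proof safe
        fix z assume z: "z \<in> Q" "z \<noteq> 0"
        then obtain i where "z $ i = 1" using Q by (force simp: vec_eq_iff)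
        moreover have "0 \<le> z $ k" for k
          using subsetD[OF Q z(1)] by (auto dest: spec[of _ k])
        then have "z $ i \<le> (\<Sum>k\<in>UNIV. z $ k)"
          by (intro member_le_sum) auto
        ultimately show "1 \<le> 1 \<bullet> z" by (simp add: inner_vec_def)
      qed
    qed (simp add: convex_halfspace_ge)
    then show ?thesis by auto
  qed
  have hull_Q: "\<exists>u z'. 0 \<le> u \<and> u \<le> 1 \<and> (u = 1 \<or> 0 \<in> Q) \<and> z' \<in> convex hull (Q - {0}) \<and> z = u *\<^sub>R z'"
    if z: "z \<in> convex hull Q" for z
  proof (cases "0 \<in> Q")
    case True
    then have "Q = insert 0 (Q - {0})" by auto
    with z have "z \<in> convex hull (insert 0 (Q - {0}))" by simp
    then obtain u v z' where "0 \<le> u" "0 \<le> v" "u + v = 1" "z' \<in> convex hull (Q - {0})"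
        "z = u *\<^sub>R 0 + v *\<^sub>R z'"
      unfolding convex_hull_insert[OF nonzero] by blast
    then show ?thesis using True by (intro exI[of _ v] exI[of _ z']) auto
  next
    case False
    then show ?thesis using z by (intro exI[of _ 1] exI[of _ z]) auto
  qed
  have nonneg: "0 \<le> \<pi> \<bullet> z" if \<pi>: "\<pi> \<in> F" and z: "z \<in> convex hull Q" for \<pi> z
  proof -
    obtain u z' where "0 \<le> u" "z' \<in> convex hull (Q - {0})" "z = u *\<^sub>R z'"
      using hull_Q[OF z] by blast
    moreover from this have "1 \<le> \<pi> \<bullet> z'" using F \<pi> by auto
    ultimately show ?thesis by simp
  qed
  have "finite Q"
  proof (rule finite_subset)
    show "Q \<subseteq> vec_lambda ` (UNIV \<rightarrow> {0, 1})"
    proof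
      fix z assume "z \<in> Q"
      then have "($) z \<in> UNIV \<rightarrow> {0, 1}" using Q by blast
      then show "z \<in> vec_lambda ` (UNIV \<rightarrow> {0, 1})"
        by (rule image_eqI[rotated]) (simp add: vec_lambda_eta)
    qed
    show "finite (vec_lambda ` ((UNIV :: 'p set) \<rightarrow> {0, 1 :: real}))"
      by (intro finite_imageI finite_PiE[of "UNIV :: 'p set" "\<lambda>_. {0, 1 :: real}",
            unfolded PiE_UNIV_domain]) auto
  qed
  then have closed_hull: "closed (convex hull Q)"
    by (intro compact_imp_closed finite_imp_compact_convex_hull)
  note region = convex_closed_perspective_region[OF f convex_convex_hull closed_hull, of F]
  have R: "convex R" "closed R"
    unfolding R_def by (rule region; use nonneg in blast)+
  have "Z_set Q f \<subseteq> R"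
  proof safe
    fix z \<beta> t assume "(z, \<beta>, t) \<in> Z_set Q f"
    then have z: "z \<in> Q" and t: "f (1 \<bullet> \<beta>) \<le> t" and \<beta>: "\<forall>i. \<beta> $ i * (1 - z $ i) = 0"
      by (auto simp: Z_set_def)
    have "perspective f (\<pi> \<bullet> z) (1 \<bullet> \<beta>) \<le> ereal t" if \<pi>: "\<pi> \<in> F" for \<pi>
    proof (cases "z = 0")
      case True
      then have "\<beta> = 0" using \<beta> by (simp add: vec_eq_iff)
      have "((\<lambda>u. ereal (u * f (0 / u))) \<longlongrightarrow> perspective f 0 0) (at_right 0)"
        by (rule perspective_tendsto[OF f])
      then have "perspective f 0 0 = 0"
        using f(2) by (simp add: tendsto_const_iff zero_ereal_def)
      then show ?thesis using True \<open>\<beta> = 0\<close> t f(2) by simp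
    next
      case False
      then have "1 \<le> \<pi> \<bullet> z" using z \<pi> F hull_inc[of z "Q - {0}"] by blast
      then have "(\<pi> \<bullet> z) * f ((1 \<bullet> \<beta>) / (\<pi> \<bullet> z)) \<le> 1 * f ((1 \<bullet> \<beta>) / 1)"
        by (intro perspective_antimono[OF f]) auto
      then show ?thesis using t \<open>1 \<le> \<pi> \<bullet> z\<close> by (simp add: perspective_def)
    qed
    then show "(z, \<beta>, t) \<in> R" using z t by (simp add: R_def hull_inc)
  qed
  then have "?C \<subseteq> R"
    using R by (intro closure_minimal hull_minimal)
  moreover have "R \<subseteq> ?C"
  proof safe
    fix z \<beta> t assume "(z, \<beta>, t) \<in> R"
    then have z: "z \<in> convex hull Q" and t: "f (1 \<bullet> \<beta>) \<le> t"
      and persp: "\<And>\<pi>. \<pi> \<in> F \<Longrightarrow> perspective f (\<pi> \<bullet> z) (1 \<bullet> \<beta>) \<le> ereal t"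
      by (auto simp: R_def)
    obtain u z' where u: "0 \<le> u" "u \<le> 1" "u = 1 \<or> 0 \<in> Q"
        and z': "z' \<in> convex hull (Q - {0})" "z = u *\<^sub>R z'"
      using hull_Q[OF z] by blast
    show "(z, \<beta>, t) \<in> ?C"
    proof (cases "u = 0")
      case True
      then have [simp]: "z = 0" using z'(2) by simp
      \<comment> \<open>Some \<open>\<pi>\<close> in \<open>F\<close> separates 0 from \<open>convex hull (Q - {0})\<close>; its constraint is the one at
        \<open>w = 0\<close>, which bounds \<open>v * f ((1 \<bullet> \<beta>) / v)\<close> for all \<open>v > 0\<close>.\<close>
      then obtain \<pi> where "\<pi> \<in> F"
        using zero_notin F z by auto
      have *: "(v *\<^sub>R z', \<beta>, t) \<in> ?C" if "0 < v" "v \<le> 1" for v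
        using u True that persp[OF \<open>\<pi> \<in> F\<close>]
        by (intro closure_convex_hull_Z_set_scaled[where f = f, OF Q f(2) conn z'(1)]
              scaled_value_le_if_perspective_le[OF f, of 0]) auto
      have "(\<lambda>n. ((1 / real (Suc n)) *\<^sub>R z', \<beta>, t)) \<longlonglongrightarrow> (0 *\<^sub>R z', \<beta>, t)"
        by (intro tendsto_intros LIMSEQ_Suc[OF lim_1_over_n])
      then have "(0 *\<^sub>R z', \<beta>, t) \<in> ?C"
        by (rule closed_sequentially[OF closed_closure, rotated]) (intro *; simp)
      then show ?thesis by simp
    next
      case False
      then have "0 < u" using u by simp
      define w where "w = Min (insert 1 ((\<lambda>\<pi>. \<pi> \<bullet> z) ` F))"
      have w_le: "w \<le> 1" "\<And>\<pi>. \<pi> \<in> F \<Longrightarrow> w \<le> \<pi> \<bullet> z"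
        unfolding w_def using assms(5) by auto
      have "w \<in> insert 1 ((\<lambda>\<pi>. \<pi> \<bullet> z) ` F)"
        unfolding w_def using assms(5) by (intro Min_in) auto
      then consider "w = 1" | \<pi> where "\<pi> \<in> F" "w = \<pi> \<bullet> z" by auto
      note w_cases = this
      have "u \<le> \<pi> \<bullet> z" if "\<pi> \<in> F" for \<pi>
        using F z' that \<open>0 < u\<close> by auto
      then have "u \<le> w" using w_cases u(2) by auto
      then have "0 < w" using \<open>0 < u\<close> by simp
      \<comment> \<open>As \<open>u \<le> w\<close>, the point \<open>z / w = (u / w) *\<^sub>R z'\<close> lies between 0 and \<open>z'\<close>.\<close>
      have "(1 / w) *\<^sub>R z \<in> convex hull Q"
      proof (cases "u = 1")
        case True
        then show ?thesis using \<open>u \<le> w\<close> w_le(1) z by simp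
      next
        case False
        then have "0 \<in> convex hull Q" using u(3) by (simp add: hull_inc)
        moreover have "z' \<in> convex hull Q" using z'(1) F by blast
        ultimately have "(1 - u / w) *\<^sub>R 0 + (u / w) *\<^sub>R z' \<in> convex hull Q"
          using \<open>u \<le> w\<close> \<open>0 < u\<close> by (intro convexD_alt convex_convex_hull) auto
        then show ?thesis using z'(2) by simp
      qed
      then have "(1 / w) *\<^sub>R z \<in> convex hull (Q - {0})"
        unfolding F using w_le(2) \<open>0 < w\<close> by (simp add: pos_le_divide_eq)
      moreover have "w * f ((1 \<bullet> \<beta>) / w) \<le> t"
        using w_cases
      proof cases
        case 1
        then show ?thesis using t by simp
      next
        case 2
        then show ?thesis using persp[of \<pi>] \<open>0 < w\<close> by (simp add: perspective_def)
      qed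
      moreover have "w = 1 \<or> 0 \<in> Q" using u \<open>u \<le> w\<close> w_le(1) by auto
      ultimately have "(w *\<^sub>R ((1 / w) *\<^sub>R z), \<beta>, t) \<in> ?C"
        using \<open>0 < w\<close> w_le(1) by (intro closure_convex_hull_Z_set_scaled[where f = f, OF Q f(2) conn])
      then show ?thesis using \<open>0 < w\<close> by simp
    qed
  qed
  moreover have "z $ i \<in> {0..1}" if "z \<in> convex hull Q" for z i
  proof -
    have "convex hull Q \<subseteq> {z. 0 \<le> axis i 1 \<bullet> z} \<inter> {z. axis i 1 \<bullet> z \<le> 1}"
    proof (intro hull_minimal convex_Int convex_halfspace_le convex_halfspace_ge subsetI)
      fix z assume "z \<in> Q"
      then have "z $ i \<in> {0, 1}" using Q by blast
      then show "z \<in> {z. 0 \<le> axis i 1 \<bullet> z} \<inter> {z. axis i 1 \<bullet> z \<le> 1}"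
        by (auto simp: inner_axis')
    qed
    then show ?thesis using that by (auto simp: inner_axis')
  qed
  ultimately show ?thesis unfolding R_def by blast
qed

end
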